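(* Let $n$ be a positive integer and $\theta>0$. For every integer $m$ with $2\le m\le n-1$, $$|R_{\theta,n;-1,-n;m}|=w^2u^2\,\tau_{-1}^{m-2}.$$
   Context: Notation: $w=\theta/n$, $u=e^{-w}$, $\tau_{-1}=(w-1)u+(1+w)u^3$. $R_{\theta,n}$ is the $n\times n$ matrix with $(k,l)$th element $(1+|k-l|w)u^{|k-l|}$. For $1\le i,j\le n$, $R_{\theta,n;-i,-j}$ is the $(n-1)\times(n-1)$ matrix obtained from $R_{\theta,n}$ by deleting the $i$th row and the $j$th column, and for $1\le m\le n-1$, $R_{\theta,n;-i,-j;m}$ is its leading $m\times m$ submatrix (first $m$ rows and first $m$ columns). $|M|$ denotes the determinant of $M$. *)

theory Defs
  imports
    Complex_Main
    "Jordan_Normal_Form.Determinant"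
    "Jordan_Normal_Form.DL_Submatrix"
begin

definition w_par :: "real \<Rightarrow> nat \<Rightarrow> real" where
  "w_par \<theta> n = \<theta> / real n"

definition u_par :: "real \<Rightarrow> nat \<Rightarrow> real" where
  "u_par \<theta> n = exp (- w_par \<theta> n)"

definition tau_minus1 :: "real \<Rightarrow> nat \<Rightarrow> real" where
  "tau_minus1 \<theta> n =
     (w_par \<theta> n - 1) * u_par \<theta> n + (1 + w_par \<theta> n) * u_par \<theta> n ^ 3"

text \<open>Matrix indices start at 0 here; the entries depend only on the distance
  \<open>\<bar>k - l\<bar>\<close>, which is computed in \<open>int\<close> to avoid truncated subtraction.\<close>

definition R_mat :: "real \<Rightarrow> nat \<Rightarrow> real mat" where
  "R_mat \<theta> n = mat n n (\<lambda>(k, l).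
     let d = nat \<bar>int k - int l\<bar>
     in (1 + real d * w_par \<theta> n) * u_par \<theta> n ^ d)"

text \<open>The row and column numbers \<open>i\<close> and \<open>j\<close> below range over \<open>1, \<dots>, n\<close>, hence the
  shift by one in the arguments of \<^const>\<open>mat_delete\<close>.\<close>

definition R_del :: "real \<Rightarrow> nat \<Rightarrow> nat \<Rightarrow> nat \<Rightarrow> real mat" where
  "R_del \<theta> n i j = mat_delete (R_mat \<theta> n) (i - 1) (j - 1)"

definition R_del_leading :: "real \<Rightarrow> nat \<Rightarrow> nat \<Rightarrow> nat \<Rightarrow> nat \<Rightarrow> real mat" where
  "R_del_leading \<theta> n i j m = submatrix (R_del \<theta> n i j) {..<m} {..<m}"

end

theory Submission
  imports Defs
begin

text \<open>
  Write \<open>f d = (1 + d w) u\<^sup>d\<close>. Deleting the first row and the last column of \<open>R\<close> moves the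
  subdiagonal onto the diagonal, so the matrix in question is the Toeplitz matrix with entries
  \<open>f \<bar>k + 1 - l\<bar>\<close>. The sequence \<open>f\<close> is a solution of the linear recurrence
  \<open>f (d + 2) = 2 u f (d + 1) - u\<^sup>2 f d\<close>, whose characteristic polynomial has the double root \<open>u\<close>.

  In a column \<open>l < k\<close> the entries of the rows \<open>k\<close>, \<open>k - 1\<close>, \<open>k - 2\<close> are consecutive values of \<open>f\<close>,
  because \<open>k - 1 - l\<close> is still nonnegative. Subtracting from the last row the combination of the two
  rows above it that the recurrence prescribes therefore annihilates it, except at the diagonal
  position. There the topmost of the three entries has the signed distance \<open>-1\<close>, where the
  absolute value folds \<open>f\<close> back and produces \<open>f 1 - 2 u f 0 + u\<^sup>2 f 1 = \<tau>\<^sub>-\<^sub>1\<close> instead of \<open>0\<close>.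
  Hence each increase of the size by one multiplies the determinant by \<open>\<tau>\<^sub>-\<^sub>1\<close>
  (\<open>det_shifted_toeplitz_Suc\<close>), down to the \<open>2 \<times> 2\<close> determinant
  \<open>(f 1)\<^sup>2 - f 0 * f 2 = w\<^sup>2 u\<^sup>2\<close>.
\<close>

definition shifted_toeplitz :: "(nat \<Rightarrow> 'a) \<Rightarrow> nat \<Rightarrow> 'a mat" where
  "shifted_toeplitz f m = mat m m (\<lambda>(k, l). f (nat \<bar>int k + 1 - int l\<bar>))"

lemma shifted_toeplitz_carrier [simp]: "shifted_toeplitz f m \<in> carrier_mat m m"
  by (simp add: shifted_toeplitz_def)

lemma shifted_toeplitz_dim [simp]:
  "dim_row (shifted_toeplitz f m) = m" "dim_col (shifted_toeplitz f m) = m"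
  by (simp_all add: shifted_toeplitz_def)

lemma shifted_toeplitz_index [simp]:
  "k < m \<Longrightarrow> l < m \<Longrightarrow> shifted_toeplitz f m $$ (k, l) = f (nat \<bar>int k + 1 - int l\<bar>)"
  by (simp add: shifted_toeplitz_def)

lemma det_last_row_single:
  fixes A :: "'a :: comm_ring_1 mat"
  assumes A: "A \<in> carrier_mat (Suc m) (Suc m)"
    and zero: "\<And>l. l < m \<Longrightarrow> A $$ (m, l) = 0"
  shows "det A = A $$ (m, m) * det (mat_delete A m m)"
proof -
  have "det A = (\<Sum>l<Suc m. A $$ (m, l) * cofactor A m l)"
    by (rule laplace_expansion_row[OF A]) simp
  also have "\<dots> = A $$ (m, m) * cofactor A m m"
    by (simp add: zero)
  also have "cofactor A m m = det (mat_delete A m m)"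
    by (simp add: cofactor_def flip: mult_2)
  finally show ?thesis .
qed

text \<open>
  The recurrence with coefficients \<open>p\<close> and \<open>q\<close> dictates the row operation: adding \<open>- p\<close> times the
  previous row and \<open>q\<close> times the one before leaves only the diagonal entry of the last row, without
  touching the leading block. Two rows above the last one must exist, which is why the reduction
  stops at size two.
\<close>

lemma det_shifted_toeplitz_Suc:
  fixes f :: "nat \<Rightarrow> 'a :: comm_ring_1"
  assumes rec: "\<And>d. f (d + 2) = p * f (d + 1) - q * f d"
    and m: "2 \<le> m"
  shows "det (shifted_toeplitz f (Suc m)) =
           (f 1 - p * f 0 + q * f 1) * det (shifted_toeplitz f m)"
proof -
  define A where "A = shifted_toeplitz f (Suc m)"
  define B where "B = addrow q m (m - 2) (addrow (- p) m (m - 1) A)"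
  have A: "A \<in> carrier_mat (Suc m) (Suc m)"
    by (simp add: A_def)
  then have B: "B \<in> carrier_mat (Suc m) (Suc m)"
    by (simp add: B_def)
  have "det B = det A"
    using m A by (simp add: B_def det_addrow[where n = "Suc m"])
  moreover have last_row: "B $$ (m, l) = f (nat \<bar>int m + 1 - int l\<bar>)
      - p * f (nat \<bar>int m - int l\<bar>) + q * f (nat \<bar>int m - 1 - int l\<bar>)" if "l \<le> m" for l
    using m that by (simp add: B_def A_def of_nat_diff algebra_simps)
  have "B $$ (m, l) = 0" if "l < m" for l
  proof -
    define d where "d = m - 1 - l"
    have "nat \<bar>int m + 1 - int l\<bar> = d + 2" "nat \<bar>int m - int l\<bar> = d + 1"
      "nat \<bar>int m - 1 - int l\<bar> = d"
      using that by (auto simp: d_def)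
    then show ?thesis
      using last_row[of l] that by (simp only: rec) simp
  qed
  then have "det B = B $$ (m, m) * det (mat_delete B m m)"
    by (rule det_last_row_single[OF B])
  moreover have "B $$ (m, m) = f 1 - p * f 0 + q * f 1"
    using last_row[of m] by simp
  moreover have "mat_delete B m m = shifted_toeplitz f m"
    using m by (intro eq_matI) (auto simp: mat_delete_def B_def A_def)
  ultimately show ?thesis
    by (simp add: A_def)
qed

lemma det_shifted_toeplitz_2:
  fixes f :: "nat \<Rightarrow> 'a :: comm_ring_1"
  shows "det (shifted_toeplitz f 2) = (f 1)\<^sup>2 - f 0 * f 2"
proof -
  have "det (shifted_toeplitz f 2) =
      (\<Sum>l<2. shifted_toeplitz f 2 $$ (0, l) * cofactor (shifted_toeplitz f 2) 0 l)"
    by (rule laplace_expansion_row) simp_all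
  also have "\<dots> = (f 1)\<^sup>2 - f 0 * f 2"
    by (simp add: numeral_2_eq_2 cofactor_def det_single mat_delete_def)
  finally show ?thesis .
qed

lemma det_shifted_toeplitz:
  fixes f :: "nat \<Rightarrow> 'a :: comm_ring_1"
  assumes rec: "\<And>d. f (d + 2) = p * f (d + 1) - q * f d"
    and m: "2 \<le> m"
  shows "det (shifted_toeplitz f m) =
           ((f 1)\<^sup>2 - f 0 * f 2) * (f 1 - p * f 0 + q * f 1) ^ (m - 2)"
  using m
proof (induction m rule: nat_induct_at_least)
  case base
  show ?case by (simp add: det_shifted_toeplitz_2)
next
  case (Suc m)
  have "Suc m - 2 = Suc (m - 2)"
    using Suc.hyps by simp
  with Suc show ?case
    by (simp only: det_shifted_toeplitz_Suc[OF rec] power_Suc mult_ac)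
qed

lemma submatrix_lessThan:
  assumes "r \<le> dim_row A" "c \<le> dim_col A"
  shows "submatrix A {..<r} {..<c} = mat r c (\<lambda>(i, j). A $$ (i, j))"
proof -
  have initial: "{i. i < d \<and> i \<in> {..<k}} = {..<k}" if "k \<le> d" for k d :: nat
    using that by auto
  have dims: "dim_row (submatrix A {..<r} {..<c}) = r" "dim_col (submatrix A {..<r} {..<c}) = c"
    by (simp_all only: dim_submatrix initial assms card_lessThan)
  have below: "{a. a < k \<and> a < i} = {..<i}" if "i < k" for i k :: nat
    using that by auto
  have "submatrix A {..<r} {..<c} $$ (i, j) = A $$ (i, j)" if "i < r" "j < c" for i j
    using submatrix_index_card[of i A j "{..<r}" "{..<c}"] assms that
    by (simp add: below)
  then show ?thesis
    using dims by (intro eq_matI) auto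
qed

definition corr :: "real \<Rightarrow> nat \<Rightarrow> nat \<Rightarrow> real" where
  "corr \<theta> n d = (1 + real d * w_par \<theta> n) * u_par \<theta> n ^ d"

lemma corr_recurrence:
  "corr \<theta> n (d + 2) = 2 * u_par \<theta> n * corr \<theta> n (d + 1) - (u_par \<theta> n)\<^sup>2 * corr \<theta> n d"
  by (simp add: corr_def algebra_simps power2_eq_square)

lemma R_del_leading_eq_shifted_toeplitz:
  assumes "m \<le> n - 1"
  shows "R_del_leading \<theta> n 1 n m = shifted_toeplitz (corr \<theta> n) m"
proof -
  have dims: "dim_row (R_del \<theta> n 1 n) = n - 1" "dim_col (R_del \<theta> n 1 n) = n - 1"
    by (simp_all add: R_del_def R_mat_def)
  have "R_del \<theta> n 1 n $$ (k, l) = corr \<theta> n (nat \<bar>int k + 1 - int l\<bar>)"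
    if "k < n - 1" "l < n - 1" for k l
    using that by (simp add: R_del_def R_mat_def mat_delete_def corr_def Let_def algebra_simps)
  then show ?thesis
    using assms dims unfolding R_del_leading_def
    by (subst submatrix_lessThan) (auto intro!: eq_matI)
qed

theorem theorem2:
  fixes n m :: nat and \<theta> :: real
  assumes "n > 0" and "\<theta> > 0" and "2 \<le> m" and "m \<le> n - 1"
  shows "det (R_del_leading \<theta> n 1 n m) =
           (w_par \<theta> n)\<^sup>2 * (u_par \<theta> n)\<^sup>2 * tau_minus1 \<theta> n ^ (m - 2)"
proof -
  let ?f = "corr \<theta> n" and ?u = "u_par \<theta> n"
  have "(?f 1)\<^sup>2 - ?f 0 * ?f 2 = (w_par \<theta> n)\<^sup>2 * ?u\<^sup>2"
    by (simp add: corr_def power2_eq_square algebra_simps)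
  moreover have "?f 1 - 2 * ?u * ?f 0 + ?u\<^sup>2 * ?f 1 = tau_minus1 \<theta> n"
    by (simp add: corr_def tau_minus1_def power2_eq_square power3_eq_cube algebra_simps)
  ultimately show ?thesis
    using det_shifted_toeplitz[where f = "corr \<theta> n", OF corr_recurrence \<open>2 \<le> m\<close>]
    by (simp only: R_del_leading_eq_shifted_toeplitz[OF \<open>m \<le> n - 1\<close>])
qed

end
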